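(* Let $p$ be an analytic function on the open unit disk $\mathbb{D}=\{z\in\mathbb{C}:|z|<1\}$, normalized such that $p(0)=1$. If \[ \left| zp'(z)+p(z)-p(z)^2\right| <\frac12 \quad \text{for all } z\in\mathbb{D}, \] then $\operatorname{Re} p(z)>0$ for all $z\in\mathbb{D}$.
   Context: $\mathbb{D}$ denotes the open unit disk in the complex plane. *)

theory Defs
  imports "HOL-Complex_Analysis.Complex_Analysis"
begin

end

theory Submission
  imports Defs
begin

text \<open>
  The proof is the classical argument of Miller and Mocanu at the first point where the real part
  of \<open>p\<close> fails to be positive. If \<open>Re p\<close> is not positive throughout the disk, there is a point
  \<open>z0\<close> of least modulus with \<open>Re (p z0) \<le> 0\<close> (lemma \<open>first_nonpositive_point\<close>); there \<open>Re p\<close>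
  vanishes, it is positive on the open disk of radius \<open>cmod z0\<close>, and it is nonnegative on the
  bounding circle. Write \<open>p z0 = \<i>a\<close> and \<open>d = z0 * p' z0\<close>.

  Two directions of approach to \<open>z0\<close> determine \<open>d\<close> well enough (lemma
  \<open>derivative_at_boundary_zero_of_Re\<close>). Along the circle \<open>Re p\<close> has a minimum at \<open>z0\<close>, which
  makes \<open>d\<close> real. Along the radius, the Schwarz lemma for the Cayley transform
  \<open>(p - 1) / (p + 1)\<close> says that \<open>p\<close> cannot reach the imaginary axis too slowly, namely
  \<open>d \<le> - (1 + a\<^sup>2) / 2\<close>.

  It remains to see that \<open>d + \<i>a + a\<^sup>2\<close>, whose real part is \<open>d + a\<^sup>2 \<le> (a\<^sup>2 - 1) / 2\<close> and
  whose imaginary part is \<open>a\<close>, has modulus at least \<open>1/2\<close>: this is clear if \<open>\<bar>a\<bar> \<ge> 1\<close>, and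
  otherwise the squared modulus is at least \<open>(1 - a\<^sup>2)\<^sup>2 / 4 + a\<^sup>2 = (1 + a\<^sup>2)\<^sup>2 / 4\<close>. That
  contradicts the hypothesis at \<open>z0\<close>.
\<close>

text \<open>
  The map \<open>w \<mapsto> (w - 1) / (w + 1)\<close> sends the right half-plane to the unit disk and \<open>1\<close> to \<open>0\<close>, so
  this is the Schwarz lemma. With the denominator cleared, the squared inequality is polynomial in
  \<open>Re (q z)\<close> and \<open>Im (q z)\<close>, hence easy to differentiate along a radius.
\<close>

lemma Schwarz_lemma_right_half_plane:
  assumes hol: "q holomorphic_on ball 0 1"
    and q0: "q 0 = 1"
    and pos: "\<And>z. cmod z < 1 \<Longrightarrow> Re (q z) > 0"
    and z: "cmod z < 1"
  shows "cmod (q z - 1) \<le> cmod z * cmod (q z + 1)"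
proof -
  define w where "w u = (q u - 1) / (q u + 1)" for u
  have nz: "q u + 1 \<noteq> 0" if "cmod u < 1" for u
    using pos[OF that] by (auto simp: complex_eq_iff)
  have "w holomorphic_on ball 0 1"
    unfolding w_def using nz by (intro holomorphic_intros hol) auto
  moreover have "w 0 = 0"
    by (simp add: w_def q0)
  moreover have "cmod (w u) < 1" if u: "cmod u < 1" for u
  proof -
    have "(cmod (q u - 1))\<^sup>2 < (cmod (q u + 1))\<^sup>2"
      using pos[OF u] unfolding cmod_power2 by (simp add: power2_eq_square algebra_simps)
    then have "cmod (q u - 1) < cmod (q u + 1)"
      by (rule power_less_imp_less_base) simp
    then show ?thesis
      using nz[OF u] by (simp add: w_def norm_divide)
  qed
  ultimately have "cmod (w z) \<le> cmod z"
    using Schwarz_Lemma(1) z by blast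
  then show ?thesis
    using nz[OF z] by (simp add: w_def norm_divide pos_divide_le_eq)
qed

text \<open>
  The half-plane version of Jack's lemma, normalized so that the boundary point is \<open>1\<close>.
  The radial bound is the first-order consequence of the Schwarz lemma becoming an equality at
  \<open>1\<close>, where \<open>q\<close> is purely imaginary.
\<close>

lemma derivative_at_boundary_zero_of_Re:
  assumes hol: "q holomorphic_on ball 0 1"
    and q0: "q 0 = 1"
    and pos: "\<And>z. cmod z < 1 \<Longrightarrow> Re (q z) > 0"
    and nonneg: "\<And>z. cmod z = 1 \<Longrightarrow> Re (q z) \<ge> 0"
    and zero: "Re (q 1) = 0"
    and der: "(q has_field_derivative d) (at 1)"
  shows "Im d = 0" and "Re d \<le> - (1 + (Im (q 1))\<^sup>2) / 2"
proof -
  define c where "c t = exp (\<i> * of_real t)" for t :: real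
  have "(c has_vector_derivative \<i>) (at 0)"
    unfolding c_def
    by (rule has_vector_derivative_real_field) (auto intro!: derivative_eq_intros)
  then have "((q \<circ> c) has_vector_derivative \<i> * d) (at 0)"
    by (rule field_vector_diff_chain_at) (simp add: c_def der)
  then have "((\<lambda>t. Re ((q \<circ> c) t)) has_real_derivative Re (\<i> * d)) (at 0)"
    by (rule has_field_derivative_Re)
  moreover have "\<forall>t. \<bar>0 - t\<bar> < 1 \<longrightarrow> Re ((q \<circ> c) 0) \<le> Re ((q \<circ> c) t)"
    using nonneg by (simp add: c_def zero)
  ultimately have "Re (\<i> * d) = 0"
    using DERIV_local_min zero_less_one by blast
  then show "Im d = 0"
    by simp

  define a where "a = Im (q 1)"
  \<comment> \<open>The difference of the squares of the two sides of the Schwarz inequality on the radius.\<close>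
  define h where "h t = (Re (q (of_real t)) - 1)\<^sup>2 + (Im (q (of_real t)))\<^sup>2
      - t\<^sup>2 * ((Re (q (of_real t)) + 1)\<^sup>2 + (Im (q (of_real t)))\<^sup>2)" for t :: real
  have vec: "((\<lambda>t. q (of_real t)) has_vector_derivative d) (at 1)"
    by (rule has_vector_derivative_real_field) (simp add: der)
  have h': "(h has_real_derivative (- 4 * Re d - 2 * (1 + a\<^sup>2))) (at 1)"
    unfolding h_def
    by (rule derivative_eq_intros has_field_derivative_Re[OF vec]
        has_field_derivative_Im[OF vec] refl)+
      (simp add: zero a_def algebra_simps power2_eq_square)
  have h_le: "h t \<le> h 1" if t: "0 < t" "t < 1" for t
  proof -
    have "cmod (q (of_real t) - 1) \<le> t * cmod (q (of_real t) + 1)"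
      using Schwarz_lemma_right_half_plane[OF hol q0 pos, of "of_real t"] t by simp
    then have "(cmod (q (of_real t) - 1))\<^sup>2 \<le> (t * cmod (q (of_real t) + 1))\<^sup>2"
      by (rule power_mono) simp
    then have "h t \<le> 0"
      by (simp add: h_def power_mult_distrib cmod_power2)
    then show ?thesis
      by (simp add: h_def zero)
  qed
  have "\<not> - 4 * Re d - 2 * (1 + a\<^sup>2) < 0"
  proof
    assume "- 4 * Re d - 2 * (1 + a\<^sup>2) < 0"
    from DERIV_neg_dec_left[OF h' this]
    obtain e where e: "e > 0" "\<And>s. s > 0 \<Longrightarrow> s < e \<Longrightarrow> h 1 < h (1 - s)"
      by blast
    define s where "s = min (e / 2) (1 / 2)"
    have "0 < s" "s < e" "s < 1"
      using e(1) by (auto simp: s_def)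
    then show False
      using e(2)[of s] h_le[of "1 - s"] by simp
  qed
  then show "Re d \<le> - (1 + (Im (q 1))\<^sup>2) / 2"
    by (simp add: a_def)
qed

text \<open>
  Minimality of the modulus gives positivity inside, and continuity carries nonnegativity over to
  the circle, in particular to the point itself.
\<close>

lemma first_nonpositive_point:
  fixes f :: "'a::euclidean_space \<Rightarrow> real"
  assumes cont: "continuous_on (ball 0 r) f"
    and f0: "f 0 > 0"
    and x: "x \<in> ball 0 r" "f x \<le> 0"
  obtains y where "y \<in> ball 0 r" "y \<noteq> 0" "f y = 0"
    and "\<And>u. norm u < norm y \<Longrightarrow> f u > 0"
    and "\<And>u. norm u = norm y \<Longrightarrow> f u \<ge> 0"
proof -
  define K where "K = {u \<in> cball 0 (norm x). f u \<le> 0}"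
  have sub: "cball 0 (norm x) \<subseteq> ball 0 r"
    using x by auto
  have "closed K"
    unfolding K_def
    by (intro continuous_on_closed_Collect_le continuous_on_subset[OF cont sub]) auto
  then have "compact K"
    by (auto simp: compact_eq_bounded_closed K_def intro: bounded_subset[of "cball 0 (norm x)"])
  moreover have "x \<in> K"
    using x by (simp add: K_def)
  ultimately obtain y where y: "y \<in> K" "\<And>u. u \<in> K \<Longrightarrow> norm y \<le> norm u"
    using continuous_attains_inf[of K norm] continuous_on_norm_id by blast
  have pos: "f u > 0" if "norm u < norm y" for u
    using y(1) y(2)[of u] that by (force simp: K_def)
  have y_in: "y \<in> ball 0 r" and fy: "f y \<le> 0"
    using y(1) x(1) by (auto simp: K_def)
  have y0: "y \<noteq> 0"
    using f0 fy by auto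
  have "cball 0 (norm y) \<subseteq> ball 0 r"
    using y_in by auto
  then have "continuous_on (closure (ball 0 (norm y))) f"
    using y0 continuous_on_subset[OF cont] by simp
  then have nonneg: "f u \<ge> 0" if "norm u = norm y" for u
    by (rule continuous_ge_on_closure) (use that y0 pos in \<open>auto intro: less_imp_le\<close>)
  show thesis
    using that[OF y_in y0 _ pos nonneg] nonneg[of y] fy by simp
qed

text \<open>
  This estimate is where the constant \<open>1/2\<close> comes from: equality holds for \<open>w = 0\<close> and
  \<open>d = - 1/2\<close>.
\<close>

lemma half_le_cmod_of_boundary_conditions:
  assumes "Re w = 0" "Im d = 0" "Re d \<le> - (1 + (Im w)\<^sup>2) / 2"
  shows "1 / 2 \<le> cmod (d + w - w\<^sup>2)"
proof (cases "\<bar>Im w\<bar> \<ge> 1")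
  case True
  have "Im (d + w - w\<^sup>2) = Im w"
    using assms by (simp add: power2_eq_square)
  then show ?thesis
    using True abs_Im_le_cmod[of "d + w - w\<^sup>2"] by simp
next
  case False
  define b where "b = (Im w)\<^sup>2"
  have b: "0 \<le> b" "b \<le> 1"
    using False by (auto simp: b_def abs_square_le_1)
  have "((1 - b) / 2)\<^sup>2 \<le> (- (Re d + b))\<^sup>2"
    using assms(3) b by (intro power_mono) (auto simp: b_def)
  then have "((1 + b) / 2)\<^sup>2 \<le> (Re d + b)\<^sup>2 + b"
    by (simp add: power2_eq_square field_simps)
  also have "\<dots> = (cmod (d + w - w\<^sup>2))\<^sup>2"
    using assms unfolding cmod_power2 b_def by (simp add: power2_eq_square)
  finally have "(1 + b) / 2 \<le> cmod (d + w - w\<^sup>2)"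
    by (rule power2_le_imp_le) simp
  then show ?thesis
    using b by simp
qed

theorem theorem2:
  fixes p :: "complex \<Rightarrow> complex"
  assumes "p analytic_on ball 0 1"
    and "p 0 = 1"
    and "\<And>z. z \<in> ball 0 1 \<Longrightarrow> cmod (z * deriv p z + p z - (p z)^2) < 1/2"
  shows "\<forall>z \<in> ball 0 1. Re (p z) > 0"
proof (rule ccontr)
  assume "\<not> (\<forall>z \<in> ball 0 1. Re (p z) > 0)"
  then obtain z1 where z1: "z1 \<in> ball 0 1" "Re (p z1) \<le> 0"
    by (auto simp: not_less)
  have hol: "p holomorphic_on ball 0 1"
    using assms(1) by (rule analytic_imp_holomorphic)
  have "continuous_on (ball 0 1) (\<lambda>z. Re (p z))"
    by (intro continuous_intros holomorphic_on_imp_continuous_on hol)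
  then obtain z0 where z0: "z0 \<in> ball 0 1" "z0 \<noteq> 0" "Re (p z0) = 0"
    and pos: "\<And>u. cmod u < cmod z0 \<Longrightarrow> Re (p u) > 0"
    and nonneg: "\<And>u. cmod u = cmod z0 \<Longrightarrow> Re (p u) \<ge> 0"
    using first_nonpositive_point[of 1 "\<lambda>z. Re (p z)" z1] z1 assms(2) by auto
  \<comment> \<open>Rescaling moves the boundary point to \<open>1\<close> and turns \<open>z0 * p' z0\<close> into a derivative.\<close>
  define q where "q z = p (z0 * z)" for z
  have small: "cmod (z0 * z) < cmod z0" if "cmod z < 1" for z
    using that z0(2) by (simp add: norm_mult)
  have "p holomorphic_on (\<lambda>z. z0 * z) ` ball 0 1"
    using hol by (rule holomorphic_on_subset) (use small z0(1) in force)
  then have hol_q: "q holomorphic_on ball 0 1"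
    unfolding q_def
    using holomorphic_on_compose[of "\<lambda>z. z0 * z" "ball 0 1" p]
    by (simp add: o_def holomorphic_intros)
  have "(p has_field_derivative deriv p z0) (at (z0 * 1))"
    using holomorphic_derivI[OF hol open_ball z0(1)] by simp
  then have der_q: "(q has_field_derivative z0 * deriv p z0) (at 1)"
    unfolding q_def
    by (rule DERIV_chain2[THEN DERIV_cong]) (auto intro!: derivative_eq_intros)
  have pos_q: "Re (q z) > 0" if "cmod z < 1" for z
    using pos small[OF that] by (simp add: q_def)
  have nonneg_q: "Re (q z) \<ge> 0" if "cmod z = 1" for z
    using nonneg that by (simp add: q_def norm_mult)
  have "q 0 = 1" "Re (q 1) = 0"
    using assms(2) z0(3) by (simp_all add: q_def)
  from derivative_at_boundary_zero_of_Re[OF hol_q this(1) pos_q nonneg_q this(2) der_q]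
  have "Im (z0 * deriv p z0) = 0" "Re (z0 * deriv p z0) \<le> - (1 + (Im (p z0))\<^sup>2) / 2"
    by (simp_all add: q_def)
  with z0(3) have "1 / 2 \<le> cmod (z0 * deriv p z0 + p z0 - (p z0)\<^sup>2)"
    by (intro half_le_cmod_of_boundary_conditions)
  with assms(3)[OF z0(1)] show False
    by simp
qed

end
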